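(* Let $(X,\tau)$ be a $T_0$ space. Then $(X,\tau)$ is p-closed if and only if $(X,\tau)$ is quasi-H-closed and strongly irresolvable.
   Context: A subset $A$ of a space $(X,\tau)$ is preopen if $A \subseteq \mathrm{int}(\mathrm{cl}(A))$; it is preclosed if its complement is preopen, i.e. $\mathrm{cl}(\mathrm{int}(A)) \subseteq A$. The preclosure $\mathrm{pcl}(A)$ is the intersection of all preclosed supersets of $A$ (it is itself preclosed). $(X,\tau)$ is p-closed if for every cover $\{V_\alpha : \alpha\in A\}$ of $X$ by preopen sets there is a finite $A_0\subseteq A$ with $X=\bigcup_{\alpha\in A_0}\mathrm{pcl}(V_\alpha)$. $(X,\tau)$ is quasi-H-closed (QHC) if for every open cover $\{V_\alpha : \alpha\in A\}$ of $X$ there is a finite $A_0\subseteq A$ with $X=\bigcup_{\alpha\in A_0}\mathrm{cl}(V_\alpha)$ (no separation axiom is included in QHC). A space is resolvable if it is the disjoint union of two dense subsets, and irresolvable otherwise; $(X,\tau)$ is strongly irresolvable if every nonempty open subspace of $X$ is irresolvable. *)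

theory Defs
  imports "HOL-Analysis.Analysis"
begin

definition preopen_in :: "'a topology \<Rightarrow> 'a set \<Rightarrow> bool" where
  "preopen_in X A \<longleftrightarrow> A \<subseteq> topspace X \<and> A \<subseteq> X interior_of (X closure_of A)"

definition preclosed_in :: "'a topology \<Rightarrow> 'a set \<Rightarrow> bool" where
  "preclosed_in X A \<longleftrightarrow> A \<subseteq> topspace X \<and> preopen_in X (topspace X - A)"

lemma preclosed_in_iff:
  "preclosed_in X A \<longleftrightarrow> A \<subseteq> topspace X \<and> X closure_of (X interior_of A) \<subseteq> A"
proof -
  have "X interior_of (X closure_of (topspace X - A)) =
      topspace X - X closure_of (X interior_of A)"
    by (simp add: closure_of_complement interior_of_complement)
  then show ?thesis
    using closure_of_subset_topspace[of X "X interior_of A"]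
    unfolding preclosed_in_def preopen_in_def by auto
qed

(* For A not contained in topspace X there is no preclosed superset and this is UNIV;
   it is only meant for subsets of topspace X. *)
definition preclosure_of :: "'a topology \<Rightarrow> 'a set \<Rightarrow> 'a set" where
  "preclosure_of X A = \<Inter>{C. preclosed_in X C \<and> A \<subseteq> C}"

lemma preclosed_in_preclosure_of:
  assumes "A \<subseteq> topspace X"
  shows "preclosed_in X (preclosure_of X A)"
proof -
  have "preclosed_in X (topspace X)"
    by (simp add: preclosed_in_iff closure_of_subset_topspace)
  then have sub: "preclosure_of X A \<subseteq> topspace X"
    using assms unfolding preclosure_of_def by blast
  have "X closure_of (X interior_of (preclosure_of X A)) \<subseteq> C"
    if "preclosed_in X C" "A \<subseteq> C" for C
  proof -
    have "preclosure_of X A \<subseteq> C"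
      using that unfolding preclosure_of_def by blast
    then have "X closure_of (X interior_of (preclosure_of X A)) \<subseteq>
        X closure_of (X interior_of C)"
      by (intro closure_of_mono interior_of_mono)
    then show ?thesis
      using that by (auto simp: preclosed_in_iff)
  qed
  then have "X closure_of (X interior_of (preclosure_of X A)) \<subseteq> preclosure_of X A"
    unfolding preclosure_of_def[of X A] by blast
  with sub show ?thesis
    by (simp add: preclosed_in_iff)
qed

definition p_closed_space :: "'a topology \<Rightarrow> bool" where
  "p_closed_space X \<longleftrightarrow>
    (\<forall>\<V>. (\<forall>V\<in>\<V>. preopen_in X V) \<and> \<Union>\<V> = topspace X \<longrightarrow>
      (\<exists>\<F>. finite \<F> \<and> \<F> \<subseteq> \<V> \<and> topspace X = (\<Union>V\<in>\<F>. preclosure_of X V)))"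

(* No separation axiom is included. *)
definition quasi_H_closed_space :: "'a topology \<Rightarrow> bool" where
  "quasi_H_closed_space X \<longleftrightarrow>
    (\<forall>\<V>. (\<forall>V\<in>\<V>. openin X V) \<and> \<Union>\<V> = topspace X \<longrightarrow>
      (\<exists>\<F>. finite \<F> \<and> \<F> \<subseteq> \<V> \<and> topspace X = (\<Union>V\<in>\<F>. X closure_of V)))"

definition resolvable_space :: "'a topology \<Rightarrow> bool" where
  "resolvable_space X \<longleftrightarrow>
    (\<exists>D E. D \<union> E = topspace X \<and> D \<inter> E = {} \<and>
      X closure_of D = topspace X \<and> X closure_of E = topspace X)"

definition strongly_irresolvable_space :: "'a topology \<Rightarrow> bool" where
  "strongly_irresolvable_space X \<longleftrightarrow>
    (\<forall>U. openin X U \<and> U \<noteq> {} \<longrightarrow> \<not> resolvable_space (subtopology X U))"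

end

theory Submission
  imports Defs
begin

text \<open>
  Everything rests on the formula \<open>pcl A = A \<union> cl (int A)\<close>. For open \<open>A\<close> it gives \<open>pcl A = cl A\<close>,
  so p-closed spaces are quasi-H-closed.

  In a strongly irresolvable space a preopen set \<open>V\<close> satisfies \<open>V \<subseteq> int (cl (int V))\<close>: otherwise
  \<open>V\<close> and its complement would both be dense in the nonempty open set
  \<open>int (cl V) - cl (int V)\<close>. A preopen cover may therefore be replaced by the open cover of the sets
  \<open>int (cl (int V))\<close>, whose closures lie in \<open>cl (int V) \<subseteq> pcl V\<close>, and quasi-H-closedness
  applies.

  It remains to see that a \<open>T\<^sub>0\<close> space with a resolvable nonempty open subspace is not p-closed. Let
  \<open>D\<close> be a dense and codense subset of the open set \<open>U\<close>. The sets \<open>(X - D) \<union> {x}\<close> with \<open>x \<in> D\<close> are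
  dense, hence preopen, and cover \<open>X\<close>. If no nonempty open subset of \<open>U\<close> meets \<open>D\<close> in a single
  point, then taking the preclosure adds no points of \<open>U\<close> to them, and \<open>D\<close> is infinite because a
  finite nonempty set in a \<open>T\<^sub>0\<close> space has a relatively isolated point; so no finite subfamily works.
  If on the contrary \<open>W \<inter> D = {x}\<close> for some open \<open>W \<subseteq> U\<close>, the same argument works for \<open>W\<close> and
  \<open>W - {x}\<close> in place of \<open>U\<close> and \<open>D\<close>: every nonempty open subset of \<open>W\<close> contains
  \<open>x\<close>, so one meeting \<open>W - {x}\<close> in a single point would have just two points, and by \<open>T\<^sub>0\<close> one
  of them would be open, against the density of both \<open>D\<close> and \<open>U - D\<close>.
\<close>

section \<open>Preclosures\<close>

text \<open>
  The right-hand side is preclosed because it has no more interior than \<open>cl (int A)\<close>: an open subset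
  of it, minus \<open>cl (int A)\<close>, is an open subset of \<open>A\<close>, hence empty.
\<close>
lemma preclosure_of_eq:
  assumes A: "A \<subseteq> topspace X"
  shows "preclosure_of X A = A \<union> X closure_of (X interior_of A)"
proof
  let ?C = "X closure_of (X interior_of A)"
  have "X interior_of (A \<union> ?C) \<subseteq> ?C"
  proof -
    let ?G = "X interior_of (A \<union> ?C) - ?C"
    have "openin X ?G"
      by (intro openin_diff openin_interior_of closedin_closure_of)
    moreover have "?G \<subseteq> A"
      using interior_of_subset by fastforce
    ultimately have "?G \<subseteq> X interior_of A"
      by (rule interior_of_maximal[rotated])
    moreover have "X interior_of A \<subseteq> ?C"
      by (simp add: closure_of_subset interior_of_subset_topspace)
    ultimately show ?thesis
      by blast
  qed
  then have "X closure_of (X interior_of (A \<union> ?C)) \<subseteq> ?C"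
    by (rule closure_of_minimal[OF _ closedin_closure_of])
  then have "preclosed_in X (A \<union> ?C)"
    using A closure_of_subset_topspace[of X "X interior_of A"]
    unfolding preclosed_in_iff by auto
  then show "preclosure_of X A \<subseteq> A \<union> ?C"
    unfolding preclosure_of_def by blast
  show "A \<union> ?C \<subseteq> preclosure_of X A"
  proof -
    have "A \<union> ?C \<subseteq> K" if K: "preclosed_in X K" "A \<subseteq> K" for K
    proof -
      have "?C \<subseteq> X closure_of (X interior_of K)"
        by (intro closure_of_mono interior_of_mono K)
      then show ?thesis
        using K by (auto simp: preclosed_in_iff)
    qed
    then show ?thesis
      unfolding preclosure_of_def by blast
  qed
qed

section \<open>Resolvability of open subspaces\<close>

lemma resolvable_open_subspace_iff:
  assumes U: "openin X U"
  shows "resolvable_space (subtopology X U) \<longleftrightarrow>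
    (\<exists>D\<subseteq>U. \<forall>W. openin X W \<and> W \<subseteq> U \<and> W \<noteq> {} \<longrightarrow> W \<inter> D \<noteq> {} \<and> W - D \<noteq> {})"
    (is "?L \<longleftrightarrow> ?R")
proof -
  have top: "topspace (subtopology X U) = U"
    using openin_subset[OF U] by auto
  have dense: "subtopology X U closure_of S = U \<longleftrightarrow>
      (\<forall>W. openin X W \<and> W \<subseteq> U \<and> W \<noteq> {} \<longrightarrow> S \<inter> W \<noteq> {})" for S
    using dense_intersects_open[of "subtopology X U" S]
    unfolding top openin_open_subtopology[OF U] by blast
  show ?thesis
  proof
    assume ?L
    then obtain D E where DE: "D \<union> E = U" "D \<inter> E = {}"
      and "subtopology X U closure_of D = U" "subtopology X U closure_of E = U"
      unfolding resolvable_space_def top by blast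
    then have "W \<inter> D \<noteq> {} \<and> W - D \<noteq> {}" if "openin X W" "W \<subseteq> U" "W \<noteq> {}" for W
      using that unfolding dense by blast
    moreover have "D \<subseteq> U"
      using DE by blast
    ultimately show ?R
      by blast
  next
    assume ?R
    then obtain D where D: "D \<subseteq> U"
      and W: "\<forall>W. openin X W \<and> W \<subseteq> U \<and> W \<noteq> {} \<longrightarrow> W \<inter> D \<noteq> {} \<and> W - D \<noteq> {}"
      by (elim exE conjE)
    have "D \<inter> W \<noteq> {}" "(U - D) \<inter> W \<noteq> {}" if "openin X W" "W \<subseteq> U" "W \<noteq> {}" for W
    proof -
      have "W \<inter> D \<noteq> {}" "W - D \<noteq> {}"
        using W that by simp_all
      then show "D \<inter> W \<noteq> {}" "(U - D) \<inter> W \<noteq> {}"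
        using that(2) by auto
    qed
    then have "subtopology X U closure_of D = U" "subtopology X U closure_of (U - D) = U"
      unfolding dense by simp_all
    with D show ?L
      unfolding resolvable_space_def top
      by (intro exI[of _ D] exI[of _ "U - D"]) auto
  qed
qed

section \<open>Quasi-H-closedness and p-closedness\<close>

lemma p_closed_imp_quasi_H_closed:
  assumes "p_closed_space X"
  shows "quasi_H_closed_space X"
  unfolding quasi_H_closed_space_def
proof (intro allI impI)
  fix \<V> assume \<V>: "(\<forall>V\<in>\<V>. openin X V) \<and> \<Union>\<V> = topspace X"
  have V: "preopen_in X V \<and> preclosure_of X V = X closure_of V" if "V \<in> \<V>" for V
  proof -
    have "openin X V"
      using \<V> that by blast
    then have "V \<subseteq> topspace X" "V \<subseteq> X closure_of V" "X interior_of V = V"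
      by (auto simp: openin_subset closure_of_subset interior_of_openin)
    then show ?thesis
      using interior_of_maximal[OF \<open>V \<subseteq> X closure_of V\<close> \<open>openin X V\<close>]
      by (auto simp: preopen_in_def preclosure_of_eq)
  qed
  then obtain \<F> where "finite \<F>" "\<F> \<subseteq> \<V>" "topspace X = (\<Union>V\<in>\<F>. preclosure_of X V)"
    using assms \<V> unfolding p_closed_space_def by meson
  moreover have "(\<Union>V\<in>\<F>. preclosure_of X V) = (\<Union>V\<in>\<F>. X closure_of V)"
    using V \<open>\<F> \<subseteq> \<V>\<close> by (intro SUP_cong) auto
  ultimately show "\<exists>\<F>. finite \<F> \<and> \<F> \<subseteq> \<V> \<and> topspace X = (\<Union>V\<in>\<F>. X closure_of V)"
    by auto
qed

text \<open>
  \<open>V\<close> and its complement are both dense in \<open>int (cl V) - cl (int V)\<close>, so strong irresolvability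
  forces that open set to be empty.
\<close>
lemma preopen_subset_interior_closure_interior:
  assumes X: "strongly_irresolvable_space X" and V: "preopen_in X V"
  shows "V \<subseteq> X interior_of (X closure_of (X interior_of V))"
proof -
  let ?U = "X interior_of (X closure_of V) - X closure_of (X interior_of V)"
  have U: "openin X ?U"
    by (intro openin_diff openin_interior_of closedin_closure_of)
  have "W \<inter> (?U \<inter> V) \<noteq> {} \<and> W - ?U \<inter> V \<noteq> {}"
    if W: "openin X W" "W \<subseteq> ?U" "W \<noteq> {}" for W
  proof
    have "W \<subseteq> X closure_of V"
      using W interior_of_subset by fastforce
    then show "W \<inter> (?U \<inter> V) \<noteq> {}"
      using openin_Int_closure_of_eq_empty[OF W(1), of V] W by blast
    show "W - ?U \<inter> V \<noteq> {}"
    proof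
      assume "W - ?U \<inter> V = {}"
      then have "W \<subseteq> X interior_of V"
        by (intro interior_of_maximal W) blast
      also have "\<dots> \<subseteq> X closure_of (X interior_of V)"
        by (simp add: closure_of_subset interior_of_subset_topspace)
      finally show False
        using W by blast
    qed
  qed
  then have "resolvable_space (subtopology X ?U)"
    unfolding resolvable_open_subspace_iff[OF U] by (intro exI[of _ "?U \<inter> V"]) auto
  with X U have "?U = {}"
    unfolding strongly_irresolvable_space_def by blast
  then have "X interior_of (X closure_of V) \<subseteq> X closure_of (X interior_of V)"
    by blast
  then have "X interior_of (X closure_of V) \<subseteq> X interior_of (X closure_of (X interior_of V))"
    by (simp add: interior_of_maximal)
  with V show ?thesis
    unfolding preopen_in_def by blast
qed

lemma quasi_H_closed_strongly_irresolvable_imp_p_closed: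
  assumes qhc: "quasi_H_closed_space X" and irr: "strongly_irresolvable_space X"
  shows "p_closed_space X"
  unfolding p_closed_space_def
proof (intro allI impI)
  fix \<V> assume \<V>: "(\<forall>V\<in>\<V>. preopen_in X V) \<and> \<Union>\<V> = topspace X"
  define R where "R V = X interior_of (X closure_of (X interior_of V))" for V
  have "V \<subseteq> R V" if "V \<in> \<V>" for V
    unfolding R_def using preopen_subset_interior_closure_interior[OF irr] \<V> that by blast
  then have "topspace X \<subseteq> \<Union>(R ` \<V>)"
    using \<V> by blast
  moreover have "R V \<subseteq> topspace X" for V
    unfolding R_def by (rule interior_of_subset_topspace)
  ultimately have "\<Union>(R ` \<V>) = topspace X"
    by blast
  moreover have "\<forall>G\<in>R ` \<V>. openin X G"
    by (auto simp: R_def)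
  ultimately obtain \<G> where "finite \<G>" "\<G> \<subseteq> R ` \<V>" and cov: "topspace X = (\<Union>G\<in>\<G>. X closure_of G)"
    using qhc unfolding quasi_H_closed_space_def by meson
  then obtain \<F> where \<F>: "\<F> \<subseteq> \<V>" "finite \<F>" "\<G> = R ` \<F>"
    by (meson finite_subset_image)
  have sub: "V \<subseteq> topspace X" if "V \<in> \<F>" for V
    using \<F> \<V> that by (auto simp: preopen_in_def)
  have "X closure_of (R V) \<subseteq> preclosure_of X V" if "V \<in> \<F>" for V
  proof -
    have "X closure_of (R V) \<subseteq> X closure_of (X interior_of V)"
      unfolding R_def by (intro closure_of_minimal interior_of_subset closedin_closure_of)
    then show ?thesis
      using sub[OF that] by (auto simp: preclosure_of_eq)
  qed
  then have "topspace X \<subseteq> (\<Union>V\<in>\<F>. preclosure_of X V)"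
    unfolding cov \<F>(3) by blast
  moreover have "preclosure_of X V \<subseteq> topspace X" if "V \<in> \<F>" for V
    using preclosed_in_preclosure_of[OF sub[OF that]] by (simp add: preclosed_in_def)
  ultimately have "topspace X = (\<Union>V\<in>\<F>. preclosure_of X V)"
    by blast
  with \<F> show "\<exists>\<F>. finite \<F> \<and> \<F> \<subseteq> \<V> \<and> topspace X = (\<Union>V\<in>\<F>. preclosure_of X V)"
    by blast
qed

section \<open>Strong irresolvability of p-closed spaces\<close>

text \<open>
  A separating open set cuts a set with at least two points down to a smaller nonempty one, so a
  minimal nonempty trace of an open set on \<open>S\<close> is a singleton.
\<close>
lemma t0_space_finite_isolated_point:
  assumes X: "t0_space X" and "finite S" "S \<noteq> {}" "S \<subseteq> topspace X"
  obtains W x where "openin X W" "W \<inter> S = {x}"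
proof -
  have "\<exists>W x. openin X W \<and> W \<inter> S = {x}"
    using assms(2-)
  proof (induction S rule: finite_psubset_induct)
    case (psubset S)
    show ?case
    proof (cases "\<exists>x. S = {x}")
      case True
      then show ?thesis
        using psubset.prems by (intro exI[of _ "topspace X"]) auto
    next
      case False
      then obtain x y where xy: "x \<in> S" "y \<in> S" "x \<noteq> y"
        using psubset.prems by blast
      then obtain V where V: "openin X V" "x \<notin> V \<longleftrightarrow> y \<in> V"
        using X psubset.prems unfolding t0_space_def by (metis subsetD)
      have "\<exists>W z. openin X W \<and> W \<inter> (V \<inter> S) = {z}"
        using xy V psubset.prems by (intro psubset.IH) auto
      then obtain W z where "openin X W" "W \<inter> (V \<inter> S) = {z}"
        by blast
      then show ?thesis
        using V by (intro exI[of _ "W \<inter> V"] exI[of _ z]) (auto simp: Int_assoc)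
    qed
  qed
  then show thesis
    using that by blast
qed

text \<open>
  The offending cover consists of the sets \<open>(X - D) \<union> {x}\<close> with \<open>x \<in> D\<close>. They are dense since \<open>D\<close>
  has empty interior. Their interiors miss \<open>U\<close>, since a nonempty open subset of \<open>U\<close> meets \<open>D\<close> in at
  least two points; hence each preclosure contains only one point of the infinite set \<open>D\<close>.
\<close>
lemma not_p_closed_space_if_multiply_dense:
  assumes X: "t0_space X" and U: "openin X U" "U \<noteq> {}" and D: "D \<subseteq> U"
    and codense: "\<And>W. openin X W \<Longrightarrow> W \<subseteq> U \<Longrightarrow> W \<noteq> {} \<Longrightarrow> W - D \<noteq> {}"
    and multiple: "\<And>W x. openin X W \<Longrightarrow> W \<subseteq> U \<Longrightarrow> W \<noteq> {} \<Longrightarrow> \<not> W \<inter> D \<subseteq> {x}"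
  shows "\<not> p_closed_space X"
proof
  assume p: "p_closed_space X"
  have D_top: "D \<subseteq> topspace X"
    using D U openin_subset by blast
  have inf: "infinite D"
  proof
    assume "finite D"
    moreover have "D \<noteq> {}"
      using multiple[OF U(1)] U(2) by blast
    ultimately obtain W x where "openin X W" "W \<inter> D = {x}"
      using t0_space_finite_isolated_point[OF X _ _ D_top] by blast
    then show False
      using multiple[of "W \<inter> U" x] U D by (auto simp: openin_Int)
  qed
  define V where "V x = insert x (topspace X - D)" for x
  have V_top: "V x \<subseteq> topspace X" if "x \<in> D" for x
    using that D_top by (auto simp: V_def)
  have "X interior_of D = {}"
    using codense[of "X interior_of D"] interior_of_subset[of X D] D by auto
  then have "X closure_of (topspace X - D) = topspace X"
    by (simp add: closure_of_complement)
  then have "X closure_of (V x) = topspace X" for x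
    using closure_of_mono[of "topspace X - D" "V x" X] closure_of_subset_topspace[of X "V x"]
    by (auto simp: V_def)
  then have "\<forall>A\<in>V ` D. preopen_in X A"
    using V_top by (auto simp: preopen_in_def interior_of_topspace)
  moreover have "\<Union>(V ` D) = topspace X"
  proof -
    have "D \<noteq> {}"
      using inf by auto
    then show ?thesis
      using V_top unfolding V_def by blast
  qed
  ultimately obtain \<F> where "finite \<F>" "\<F> \<subseteq> V ` D"
    and cov: "topspace X = (\<Union>A\<in>\<F>. preclosure_of X A)"
    using p unfolding p_closed_space_def by meson
  then obtain S where S: "S \<subseteq> D" "finite S" "\<F> = V ` S"
    by (meson finite_subset_image)
  then obtain y where y: "y \<in> D" "y \<notin> S"
    using inf by (metis finite_subset subsetI)
  then obtain x where x: "x \<in> S" "y \<in> preclosure_of X (V x)"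
    using cov S D_top by auto
  have "y \<in> X closure_of (X interior_of (V x))"
    using x y S V_top by (auto simp: preclosure_of_eq V_def)
  then have "U \<inter> X interior_of (V x) \<noteq> {}"
    using y D U by (auto simp: in_closure_of)
  moreover have "U \<inter> X interior_of (V x) \<inter> D \<subseteq> {x}"
    using interior_of_subset[of X "V x"] by (auto simp: V_def)
  ultimately show False
    using multiple[of "U \<inter> X interior_of (V x)" x] U by (auto simp: openin_Int)
qed

text \<open>
  If some open \<open>W\<close> meets the dense set \<open>D\<close> in one point \<open>x\<close> only, the roles of the two dense sets are
  exchanged inside \<open>W\<close>: every nonempty open subset of \<open>W\<close> contains \<open>x\<close>, and the \<open>T\<^sub>0\<close> axiom makes
  \<open>W - {x}\<close> meet it in more than one further point.
\<close>
lemma t0_p_closed_imp_strongly_irresolvable: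
  assumes X: "t0_space X" and p: "p_closed_space X"
  shows "strongly_irresolvable_space X"
  unfolding strongly_irresolvable_space_def
proof (intro allI impI notI)
  fix U assume U: "openin X U \<and> U \<noteq> {}"
  assume "resolvable_space (subtopology X U)"
  then obtain D where D: "D \<subseteq> U"
    and "\<forall>W. openin X W \<and> W \<subseteq> U \<and> W \<noteq> {} \<longrightarrow> W \<inter> D \<noteq> {} \<and> W - D \<noteq> {}"
    using resolvable_open_subspace_iff[of X U] U by auto
  then have res: "W \<inter> D \<noteq> {} \<and> W - D \<noteq> {}" if "openin X W" "W \<subseteq> U" "W \<noteq> {}" for W
    using that by simp
  obtain W x where W: "openin X W" "W \<subseteq> U" "W \<noteq> {}" and "W \<inter> D \<subseteq> {x}"
    using not_p_closed_space_if_multiply_dense[OF X _ _ D] U res p by blast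
  then have WD: "W \<inter> D = {x}"
    using res[OF W] by blast
  have x_in: "x \<in> G" if "openin X G" "G \<subseteq> W" "G \<noteq> {}" for G
  proof -
    have "G \<inter> D \<noteq> {}"
      using res[of G] that W(2) by auto
    moreover have "G \<inter> D \<subseteq> {x}"
      using that(2) WD by auto
    ultimately show ?thesis
      by auto
  qed
  obtain G y where G: "openin X G" "G \<subseteq> W" "G \<noteq> {}" and "G \<inter> (W - {x}) \<subseteq> {y}"
  proof -
    have "G - (W - {x}) \<noteq> {}" if "openin X G" "G \<subseteq> W" "G \<noteq> {}" for G
      using x_in[OF that] by blast
    then show thesis
      using not_p_closed_space_if_multiply_dense[OF X W(1,3), of "W - {x}"] p that by blast
  qed
  then have "G \<subseteq> {x, y}"
    by blast
  then have "finite G"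
    by (rule finite_subset) simp
  \<comment> \<open>A point isolated in \<open>G\<close> is open, and an open singleton cannot meet both \<open>D\<close> and \<open>U - D\<close>.\<close>
  then obtain V z where "openin X V" "V \<inter> G = {z}"
    using t0_space_finite_isolated_point[OF X _ G(3) openin_subset[OF G(1)]] by blast
  then have "openin X {z}" "z \<in> U"
    using G W openin_Int[of X V G] by auto
  then show False
    using res[of "{z}"] by auto
qed

section \<open>The characterization of p-closed spaces\<close>

theorem theorem2p4:
  fixes X :: "'a topology"
  assumes "t0_space X"
  shows "p_closed_space X \<longleftrightarrow> quasi_H_closed_space X \<and> strongly_irresolvable_space X"
  using assms p_closed_imp_quasi_H_closed t0_p_closed_imp_strongly_irresolvable
    quasi_H_closed_strongly_irresolvable_imp_p_closed
  by blast

end
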